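(* Let $\varepsilon>0$ and let $(u_n)_{n=0}^{\infty}$ be an $\varepsilon$-monotone real sequence. Then there exists a continuous, almost everywhere differentiable, $\varepsilon$-monotone function $f:\mathbb{R}_+\to\mathbb{R}$ satisfying $f(n)=u_n$ for all $n\in\mathbb{N}\cup\{0\}$. Additionally, there exists a non-decreasing sequence $(v_n)_{n=0}^{\infty}$ such that $$|u_n-v_n|\le\frac{\varepsilon}{2}\quad\text{for all } n\in\mathbb{N}\cup\{0\}.$$
   Context: $\mathbb{N}=\{1,2,\dots\}$ and $\mathbb{R}_+=[0,\infty)$. A real sequence $(u_n)_{n=0}^{\infty}$ is $\varepsilon$-monotone if $u_m\le u_n+\varepsilon$ for all integers $0\le m<n$. A function $f:\mathbb{R}_+\to\mathbb{R}$ is $\varepsilon$-monotone if $f(x)\le f(y)+\varepsilon$ for all $x,y\in\mathbb{R}_+$ with $x<y$. *)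

theory Defs
  imports "HOL-Analysis.Analysis"
begin

text \<open>One notion serves both cases: sequences take \<open>A = UNIV :: nat set\<close>, and functions on the
  half-line take \<open>A = {0..}\<close>.\<close>

definition eps_monotone_on :: "'a::linorder set \<Rightarrow> real \<Rightarrow> ('a \<Rightarrow> real) \<Rightarrow> bool" where
  "eps_monotone_on A \<epsilon> f \<longleftrightarrow> (\<forall>x\<in>A. \<forall>y\<in>A. x < y \<longrightarrow> f x \<le> f y + \<epsilon>)"

end

theory Submission
  imports Defs
begin

text \<open>For the function take the piecewise linear interpolation of \<open>u\<close>. Its values on
  \<open>[n, n + 1]\<close> lie between \<open>u n\<close> and \<open>u (n + 1)\<close>. If \<open>x < y\<close> lie in different unit intervals,
  every node adjacent to \<open>x\<close> is thus at or before every node adjacent to \<open>y\<close>, and the drop from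
  \<open>x\<close> to \<open>y\<close> is at most a drop of \<open>u\<close>; within one interval the function is affine, so the drop is
  the fraction \<open>y - x \<le> 1\<close> of the drop \<open>u n - u (n + 1) \<le> \<epsilon>\<close>. Differentiability can fail only at
  the integers, a null set.

  For the monotone sequence, the running maximum of \<open>u\<close> is non-decreasing and exceeds \<open>u\<close> by an
  amount in \<open>[0, \<epsilon>]\<close>; lowering it by \<open>\<epsilon> / 2\<close> centres this error.\<close>

definition linear_interpolation :: "(nat \<Rightarrow> real) \<Rightarrow> real \<Rightarrow> real" where
  "linear_interpolation u x =
     u (nat \<lfloor>x\<rfloor>) + (x - real (nat \<lfloor>x\<rfloor>)) * (u (Suc (nat \<lfloor>x\<rfloor>)) - u (nat \<lfloor>x\<rfloor>))"

text \<open>The closed interval on the right matters: the formula of one piece agrees with that of the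
  next at the shared endpoint, which is why the pieces glue continuously.\<close>

lemma linear_interpolation_eq:
  assumes "real n \<le> x" "x \<le> real (Suc n)"
  shows "linear_interpolation u x = u n + (x - real n) * (u (Suc n) - u n)"
proof (cases "x = real (Suc n)")
  case True
  then have "nat \<lfloor>x\<rfloor> = Suc n"
    by linarith
  then show ?thesis
    using True by (simp add: linear_interpolation_def)
next
  case False
  then have "nat \<lfloor>x\<rfloor> = n"
    using assms by linarith
  then show ?thesis
    by (simp add: linear_interpolation_def)
qed

lemma linear_interpolation_of_nat [simp]: "linear_interpolation u (real n) = u n"
  by (simp add: linear_interpolation_def)

lemma linear_interpolation_le:
  assumes "real n \<le> x" "x \<le> real (Suc n)" "u n \<le> c" "u (Suc n) \<le> c"
  shows "linear_interpolation u x \<le> c"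
proof -
  have "linear_interpolation u x = (1 - (x - real n)) * u n + (x - real n) * u (Suc n)"
    using assms by (simp add: linear_interpolation_eq algebra_simps)
  also have "\<dots> \<le> c"
    using assms by (intro convex_bound_le) auto
  finally show ?thesis .
qed

lemma linear_interpolation_uminus:
  "linear_interpolation (\<lambda>n. - u n) x = - linear_interpolation u x"
  by (simp add: linear_interpolation_def algebra_simps)

lemma linear_interpolation_ge:
  assumes "real n \<le> x" "x \<le> real (Suc n)" "c \<le> u n" "c \<le> u (Suc n)"
  shows "c \<le> linear_interpolation u x"
  using linear_interpolation_le[of n x "\<lambda>n. - u n" "- c"] assms
  by (simp add: linear_interpolation_uminus)

lemma continuous_on_linear_interpolation: "continuous_on {0..} (linear_interpolation u)"
proof -
  have initial: "continuous_on {0..real n} (linear_interpolation u)" for n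
  proof (induction n)
    case 0
    then show ?case by simp
  next
    case (Suc n)
    have "continuous_on {real n..real (Suc n)} (\<lambda>x. u n + (x - real n) * (u (Suc n) - u n))"
      by (intro continuous_intros)
    then have "continuous_on {real n..real (Suc n)} (linear_interpolation u)"
      by (rule continuous_on_eq) (auto simp: linear_interpolation_eq[of n])
    with Suc have "continuous_on ({0..real n} \<union> {real n..real (Suc n)}) (linear_interpolation u)"
      by (intro continuous_on_closed_Un) auto
    moreover have "{0..real n} \<union> {real n..real (Suc n)} = {0..real (Suc n)}"
      by auto
    ultimately show ?case by simp
  qed
  show ?thesis
    unfolding continuous_on_eq_continuous_within
  proof
    fix x :: real assume "x \<in> {0..}"
    obtain n where n: "x < real n"
      using reals_Archimedean2 by blast
    have "at x within {0..} = at x within {0..real n}"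
      by (rule at_within_nhd[of x "{..<real n}"]) (use n in auto)
    then show "continuous (at x within {0..}) (linear_interpolation u)"
      using initial[of n] n \<open>x \<in> {0..}\<close> by (simp add: continuous_on_eq_continuous_within)
  qed
qed

lemma linear_interpolation_differentiable:
  assumes "real n < x" "x < real (Suc n)"
  shows "linear_interpolation u differentiable (at x within S)"
proof -
  have "(\<lambda>x. u n + (x - real n) * (u (Suc n) - u n)) differentiable (at x)"
    by (intro derivative_intros)
  then obtain D where "((\<lambda>x. u n + (x - real n) * (u (Suc n) - u n)) has_derivative D) (at x)"
    unfolding differentiable_def by blast
  then have "(linear_interpolation u has_derivative D) (at x)"
    by (rule has_derivative_transform_within_open[where s = "{real n<..<real (Suc n)}"])
      (use assms in \<open>auto simp: linear_interpolation_eq[of n]\<close>)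
  then show ?thesis
    by (meson differentiableI differentiable_at_withinI)
qed

lemma AE_linear_interpolation_differentiable:
  "AE x in lebesgue_on {0..}. linear_interpolation u differentiable (at x within {0..})"
proof -
  have "range real \<in> null_sets lborel"
    by (intro countable_imp_null_set_lborel) simp
  then have "AE x in lebesgue. x \<notin> range real"
    by (intro AE_completion AE_not_in)
  then have "AE x in lebesgue. x \<in> {0..} \<longrightarrow>
      linear_interpolation u differentiable (at x within {0..})"
  proof (rule eventually_mono, intro impI)
    fix x :: real assume x: "x \<notin> range real" "x \<in> {0..}"
    have "x \<noteq> real (nat \<lfloor>x\<rfloor>)"
      using x by blast
    then have "real (nat \<lfloor>x\<rfloor>) < x" "x < real (Suc (nat \<lfloor>x\<rfloor>))"
      using x(2) by auto linarith+
    then show "linear_interpolation u differentiable (at x within {0..})"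
      by (rule linear_interpolation_differentiable)
  qed
  then show ?thesis
    by (simp add: AE_restrict_space_iff)
qed

lemma eps_monotone_on_le:
  assumes "eps_monotone_on A \<epsilon> f" "0 \<le> \<epsilon>" "x \<in> A" "y \<in> A" "x \<le> y"
  shows "f x \<le> f y + \<epsilon>"
  using assms by (cases "x = y") (auto simp: eps_monotone_on_def)

lemma eps_monotone_on_linear_interpolation:
  assumes "0 \<le> \<epsilon>" "eps_monotone_on UNIV \<epsilon> u"
  shows "eps_monotone_on {0..} \<epsilon> (linear_interpolation u)"
  unfolding eps_monotone_on_def
proof (intro ballI impI)
  fix x y :: real
  assume "x \<in> {0..}" "y \<in> {0..}" "x < y"
  define n m where "n = nat \<lfloor>x\<rfloor>" and "m = nat \<lfloor>y\<rfloor>"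
  have n: "real n \<le> x" "x \<le> real (Suc n)" and m: "real m \<le> y" "y \<le> real (Suc m)"
    using \<open>x \<in> {0..}\<close> \<open>y \<in> {0..}\<close> unfolding n_def m_def by (auto; linarith)+
  have "n \<le> m"
    using \<open>x < y\<close> unfolding n_def m_def by (intro nat_mono floor_mono) simp
  have u: "u i - \<epsilon> \<le> u j" if "i \<le> j" for i j
    using eps_monotone_on_le[OF assms(2,1) _ _ that] by simp
  show "linear_interpolation u x \<le> linear_interpolation u y + \<epsilon>"
  proof (cases "n = m")
    case True
    have "linear_interpolation u x - linear_interpolation u y = (y - x) * (u n - u (Suc n))"
      using n m True by (simp add: linear_interpolation_eq algebra_simps)
    also have "\<dots> \<le> (y - x) * \<epsilon>"
      using \<open>x < y\<close> u[of n "Suc n"] by (intro mult_left_mono) auto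
    also have "\<dots> \<le> 1 * \<epsilon>"
      using n m True assms(1) by (intro mult_right_mono) auto
    finally show ?thesis by simp
  next
    case False
    then have "Suc n \<le> m"
      using \<open>n \<le> m\<close> by simp
    then have "linear_interpolation u x - \<epsilon> \<le> u j" if "j \<in> {m, Suc m}" for j
      using linear_interpolation_le[OF n, of u "u j + \<epsilon>"] u[of n j] u[of "Suc n" j] that
      by fastforce
    then show ?thesis
      using linear_interpolation_ge[OF m, of "linear_interpolation u x - \<epsilon>" u] by simp
  qed
qed

lemma eps_monotone_sequence_near_mono:
  fixes u :: "nat \<Rightarrow> real"
  assumes "0 \<le> \<epsilon>" "eps_monotone_on UNIV \<epsilon> u"
  shows "\<exists>v. mono v \<and> (\<forall>n. \<bar>u n - v n\<bar> \<le> \<epsilon> / 2)"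
proof (intro exI conjI allI)
  let ?v = "\<lambda>n. Max (u ` {..n}) - \<epsilon> / 2"
  show "mono ?v"
    by (intro monoI diff_right_mono Max_mono) auto
  fix n
  have "u n \<le> Max (u ` {..n})"
    by (intro Max_ge) auto
  moreover have "Max (u ` {..n}) \<le> u n + \<epsilon>"
    using eps_monotone_on_le[OF assms(2,1)] by (intro Max.boundedI) auto
  ultimately show "\<bar>u n - ?v n\<bar> \<le> \<epsilon> / 2"
    by linarith
qed

theorem theorem1p4:
  fixes \<epsilon> :: real and u :: "nat \<Rightarrow> real"
  assumes "\<epsilon> > 0"
    and "eps_monotone_on UNIV \<epsilon> u"
  shows "(\<exists>f :: real \<Rightarrow> real.
            continuous_on {0..} f \<and>
            (AE x in lebesgue_on {0..}. f differentiable (at x within {0..})) \<and>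
            eps_monotone_on {0..} \<epsilon> f \<and>
            (\<forall>n. f (real n) = u n)) \<and>
         (\<exists>v :: nat \<Rightarrow> real. mono v \<and> (\<forall>n. \<bar>u n - v n\<bar> \<le> \<epsilon> / 2))"
proof
  show "\<exists>f :: real \<Rightarrow> real.
            continuous_on {0..} f \<and>
            (AE x in lebesgue_on {0..}. f differentiable (at x within {0..})) \<and>
            eps_monotone_on {0..} \<epsilon> f \<and>
            (\<forall>n. f (real n) = u n)"
    using assms
    by (intro exI[of _ "linear_interpolation u"])
      (simp add: continuous_on_linear_interpolation AE_linear_interpolation_differentiable
        eps_monotone_on_linear_interpolation)
  show "\<exists>v :: nat \<Rightarrow> real. mono v \<and> (\<forall>n. \<bar>u n - v n\<bar> \<le> \<epsilon> / 2)"
    using assms by (intro eps_monotone_sequence_near_mono) auto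
qed

end
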